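(* Let $G$ be a fixed simple connected undirected triangle-free regular graph, and let $H$ be any simple connected undirected regular graph whose least adjacency eigenvalue is at least $-2$. Then, for any such graphs $H$ with the same order and the same regularity: (i) the graphs $G\dot{\vee}H$ form a family of $D$-equienergetic graphs; (ii) the graphs $G\veebar H$ form a family of $D$-equienergetic graphs. That is, if $H_1,H_2$ are two such graphs (same order, same regularity, least adjacency eigenvalue at least $-2$), then $G\dot{\vee}H_1$ and $G\dot{\vee}H_2$ have the same distance energy, and $G\veebar H_1$ and $G\veebar H_2$ have the same distance energy.
   Context: For a connected graph $X$, the distance matrix $D(X)$ is the symmetric matrix of shortest-path distances between vertices; its eigenvalues are the distance eigenvalues of $X$, and the distance energy $E_D(X)$ is the sum of their absolute values (with multiplicity). Two graphs with the same number of vertices are $D$-equienergetic if they have the same distance energy. The subdivision graph $S(X)$ of a graph $X$ is obtained by subdividing each edge of $X$ exactly once, i.e. inserting one new vertex on each edge. The central graph $C(X)$ is obtained from $S(X)$ by joining every pair of distinct vertices of $V(X)$ that are non-adjacent in $X$. For vertex-disjoint graphs $G_1,G_2$: the central vertex join $G_1\dot{\vee}G_2$ is obtained from $C(G_1)$ and $G_2$ by joining each vertex of $V(G_1)$ to every vertex of $G_2$; the central edge join $G_1\veebar G_2$ is obtained from $C(G_1)$ and $G_2$ by joining each vertex of $C(G_1)$ corresponding to an edge of $G_1$ to every vertex of $G_2$. *)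

theory Defs
  imports
    "Graph_Theory.Pair_Digraph"
    "Graph_Theory.Digraph_Component"
    "Graph_Theory.Shortest_Path"
    "Jordan_Normal_Form.Spectral_Radius"
begin

text \<open>
  A finite simple undirected graph is a \<^locale>\<open>pair_graph\<close>: both arcs (u,v) and (v,u)
  are present for every edge uv, and connectedness includes non-emptiness.
\<close>

definition edge_set :: "'a pair_pre_digraph \<Rightarrow> 'a set set" where
  "edge_set X = {{u, v} | u v. (u, v) \<in> parcs X}"

definition regular :: "nat \<Rightarrow> 'a pair_pre_digraph \<Rightarrow> bool" where
  "regular r X \<longleftrightarrow> (\<forall>v\<in>pverts X. out_degree (with_proj X) v = r)"

definition triangle_free :: "'a pair_pre_digraph \<Rightarrow> bool" where
  "triangle_free X \<longleftrightarrow>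
     \<not> (\<exists>u v w. (u, v) \<in> parcs X \<and> (v, w) \<in> parcs X \<and> (w, u) \<in> parcs X)"


section \<open>Central graphs and their joins\<close>

text \<open>The vertex inserted on the edge uv is \<open>Inr {u, v}\<close>.\<close>

definition subdivision_graph :: "'a pair_pre_digraph \<Rightarrow> ('a + 'a set) pair_pre_digraph" where
  "subdivision_graph X =
     \<lparr> pverts = Inl ` pverts X \<union> Inr ` edge_set X,
       parcs = {(Inl v, Inr e) | v e. e \<in> edge_set X \<and> v \<in> e}
             \<union> {(Inr e, Inl v) | v e. e \<in> edge_set X \<and> v \<in> e} \<rparr>"

definition central_graph :: "'a pair_pre_digraph \<Rightarrow> ('a + 'a set) pair_pre_digraph" where
  "central_graph X =
     \<lparr> pverts = pverts (subdivision_graph X),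
       parcs = parcs (subdivision_graph X)
             \<union> {(Inl u, Inl v) | u v. u \<in> pverts X \<and> v \<in> pverts X \<and> u \<noteq> v \<and> (u, v) \<notin> parcs X} \<rparr>"

text \<open>The disjoint union of X and Y, with every vertex in S joined to every vertex of Y.\<close>

definition join_on ::
  "'a set \<Rightarrow> 'a pair_pre_digraph \<Rightarrow> 'b pair_pre_digraph \<Rightarrow> ('a + 'b) pair_pre_digraph" where
  "join_on S X Y =
     \<lparr> pverts = Inl ` pverts X \<union> Inr ` pverts Y,
       parcs = {(Inl u, Inl v) | u v. (u, v) \<in> parcs X}
             \<union> {(Inr u, Inr v) | u v. (u, v) \<in> parcs Y}
             \<union> {(Inl u, Inr v) | u v. u \<in> S \<and> v \<in> pverts Y}
             \<union> {(Inr v, Inl u) | u v. u \<in> S \<and> v \<in> pverts Y} \<rparr>"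

definition central_vertex_join ::
  "'a pair_pre_digraph \<Rightarrow> 'b pair_pre_digraph \<Rightarrow> (('a + 'a set) + 'b) pair_pre_digraph" where
  "central_vertex_join G H = join_on (Inl ` pverts G) (central_graph G) H"

definition central_edge_join ::
  "'a pair_pre_digraph \<Rightarrow> 'b pair_pre_digraph \<Rightarrow> (('a + 'a set) + 'b) pair_pre_digraph" where
  "central_edge_join G H = join_on (Inr ` edge_set G) (central_graph G) H"

lemma finite_edge_set:
  assumes "pair_graph X" shows "finite (edge_set X)"
proof -
  interpret pair_graph X by fact
  have "edge_set X = (\<lambda>(u, v). {u, v}) ` parcs X"
    by (auto simp: edge_set_def)
  then show ?thesis using pair_finite_arcs by simp
qed

lemma edge_set_in_verts:
  assumes "pair_graph X" "e \<in> edge_set X" "v \<in> e" shows "v \<in> pverts X"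
proof -
  interpret pair_graph X by fact
  show ?thesis using assms(2,3) by (auto simp: edge_set_def dest: wellformed')
qed

lemma pair_graphI:
  assumes "finite (pverts X)" "parcs X \<subseteq> pverts X \<times> pverts X" "sym (parcs X)" "irrefl (parcs X)"
  shows "pair_graph X"
proof
  show "finite (parcs X)" using assms(1,2) finite_subset by blast
  show "symmetric (with_proj X)" using assms(3) by (simp add: symmetric_def)
qed (use assms in \<open>auto simp: irrefl_def\<close>)

lemma pair_graphD:
  assumes "pair_graph X"
  shows "finite (pverts X)" "parcs X \<subseteq> pverts X \<times> pverts X" "sym (parcs X)" "irrefl (parcs X)"
proof -
  interpret pair_graph X by fact
  show "finite (pverts X)" by (rule pair_finite_verts)
  show "parcs X \<subseteq> pverts X \<times> pverts X" by (auto dest: wellformed')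
  show "sym (parcs X)" by (auto intro: symI arcs_symmetric)
  show "irrefl (parcs X)" using no_loops' by (auto simp: irrefl_def)
qed

lemma pair_graph_central_graph:
  assumes "pair_graph X" shows "pair_graph (central_graph X)"
proof (rule pair_graphI)
  show "sym (parcs (central_graph X))"
    using pair_graphD(3)[OF assms]
    by (auto simp: central_graph_def subdivision_graph_def sym_def)
qed (use pair_graphD(1)[OF assms] finite_edge_set[OF assms] edge_set_in_verts[OF assms] in
      \<open>auto simp: central_graph_def subdivision_graph_def irrefl_def\<close>)

lemma pair_graph_join_on:
  assumes "pair_graph X" "pair_graph Y" "S \<subseteq> pverts X" shows "pair_graph (join_on S X Y)"
proof (rule pair_graphI)
  show "sym (parcs (join_on S X Y))"
    using pair_graphD(3)[OF assms(1)] pair_graphD(3)[OF assms(2)]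
    by (auto simp: join_on_def sym_def)
  show "irrefl (parcs (join_on S X Y))"
    using pair_graphD(4)[OF assms(1)] pair_graphD(4)[OF assms(2)]
    by (auto simp: join_on_def irrefl_def)
qed (use pair_graphD(1,2)[OF assms(1)] pair_graphD(1,2)[OF assms(2)] assms(3) in
      \<open>auto simp: join_on_def\<close>)

lemma pair_graph_central_joins:
  assumes "pair_graph G" "pair_graph H"
  shows "pair_graph (central_vertex_join G H)" "pair_graph (central_edge_join G H)"
  unfolding central_vertex_join_def central_edge_join_def
  by (intro pair_graph_join_on pair_graph_central_graph assms;
      auto simp: central_graph_def subdivision_graph_def)+


section \<open>Adjacency and distance spectra\<close>

text \<open>
  Matrices of a graph refer to an arbitrary but fixed enumeration of its vertices; another
  enumeration conjugates them by a permutation matrix, so the spectra do not depend on it.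
\<close>

definition vertex_list :: "'a pair_pre_digraph \<Rightarrow> 'a list" where
  "vertex_list X = (SOME vs. distinct vs \<and> set vs = pverts X)"

definition vertex_matrix :: "'a pair_pre_digraph \<Rightarrow> ('a \<Rightarrow> 'a \<Rightarrow> real) \<Rightarrow> real mat" where
  "vertex_matrix X f = mat (card (pverts X)) (card (pverts X))
     (\<lambda>(i, j). f (vertex_list X ! i) (vertex_list X ! j))"

definition adjacency_matrix :: "'a pair_pre_digraph \<Rightarrow> real mat" where
  "adjacency_matrix X = vertex_matrix X (\<lambda>u v. if (u, v) \<in> parcs X then 1 else 0)"

definition least_adjacency_eigenvalue :: "'a pair_pre_digraph \<Rightarrow> real" where
  "least_adjacency_eigenvalue X = Min (spectrum (adjacency_matrix X))"

definition graph_dist :: "'a pair_pre_digraph \<Rightarrow> 'a \<Rightarrow> 'a \<Rightarrow> real" where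
  "graph_dist X u v = real_of_ereal (wf_digraph.\<mu> (with_proj X) (\<lambda>_. 1) u v)"

definition distance_matrix :: "'a pair_pre_digraph \<Rightarrow> real mat" where
  "distance_matrix X = vertex_matrix X (graph_dist X)"

text \<open>
  The matrix is real symmetric, so the real eigenvalues are all of them, and algebraic and
  geometric multiplicities agree.
\<close>

definition distance_energy :: "'a pair_pre_digraph \<Rightarrow> real" where
  "distance_energy X =
     (\<Sum>k \<in> spectrum (distance_matrix X).
        real (Polynomial.order k (char_poly (distance_matrix X))) * \<bar>k\<bar>)"

text \<open>
  Distance energy is a notion for connected graphs only; outside them \<^const>\<open>graph_dist\<close>
  takes junk values, so connectedness is part of the definition.
\<close>

definition D_equienergetic :: "'a pair_pre_digraph \<Rightarrow> 'b pair_pre_digraph \<Rightarrow> bool" where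
  "D_equienergetic X Y \<longleftrightarrow>
     Digraph_Component.connected (with_proj X) \<and> Digraph_Component.connected (with_proj Y) \<and>
     card (pverts X) = card (pverts Y) \<and> distance_energy X = distance_energy Y"

end

theory Submission
  imports Defs
begin

text \<open>
  Both joins are of the form \<open>join_on S X Y\<close> with \<open>X\<close> the central graph of \<open>G\<close> and \<open>S\<close> a set
  that dominates \<open>X\<close>, namely the vertices of \<open>G\<close> or the midpoints of its edges. For all joins of this
  form, the distance energy depends on \<open>X\<close>, \<open>S\<close>, the order \<open>n\<close> and the degree \<open>r\<close> of \<open>Y\<close> only, as
  soon as the least adjacency eigenvalue of \<open>Y\<close> is at least \<open>- 2\<close> (\<open>distance_energy_J\<close>).

  Collapsing \<open>Y\<close> to a single vertex of another graph \<open>Z\<close> maps arcs of \<open>join_on S X Y\<close> to arcs of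
  \<open>join_on S X Z\<close> or to single vertices, hence does not increase distances. As this works in both
  directions, the distances inside \<open>X\<close> and the distance from \<open>x \<in> X\<close> to any vertex of \<open>Y\<close> are the
  same for all \<open>Y\<close>; they can be read off from the cone in which \<open>Y\<close> is one point. Two distinct
  vertices of \<open>Y\<close> have distance 1 if adjacent and otherwise 2, through \<open>S\<close>. With
  \<open>B = - 2 I - A(Y)\<close>, the distance matrix is therefore, with blocks written row by row,
  \<open>[M, b 1\<^sup>T; 1 b\<^sup>T, 2 1 1\<^sup>T + B]\<close>, and \<open>M\<close> and \<open>b\<close> do not depend on \<open>Y\<close>.

  By regularity, the all-ones vector is an eigenvector of \<open>B\<close> for \<open>\<beta> = - 2 - r\<close>, and the other
  eigenvalues of \<open>B\<close> pass unchanged to the distance matrix: if \<open>Q\<close> is the quotient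
  matrix that lumps \<open>Y\<close> together, then \<open>\<chi>\<^sub>D (x - \<beta>) = \<chi>\<^sub>Q \<chi>\<^sub>B\<close> (\<open>char_poly_quotient\<close>).
  All eigenvalues of \<open>B\<close> are nonpositive by the assumption on \<open>Y\<close>, so the sum of their
  absolute values is minus the trace of \<open>B\<close>, which is \<open>2 n\<close>. The distance energy is thus
  \<open>E(Q) + 2 n - (2 + r)\<close>, where \<open>E(Q)\<close> sums the absolute values of the real eigenvalues of \<open>Q\<close>,
  counted with multiplicity.
\<close>

section \<open>Characteristic polynomials and enumerations of the vertices\<close>

lemma char_poly_permute:
  fixes f :: "nat \<Rightarrow> nat \<Rightarrow> 'a :: comm_ring_1"
  assumes p: "p permutes {0..<n}"
  shows "char_poly (mat n n (\<lambda>(i, j). f (p i) (p j))) = char_poly (mat n n (\<lambda>(i, j). f i j))"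
proof -
  let ?C = "char_poly_matrix (mat n n (\<lambda>(i, j). f i j))"
  have pn: "p i < n" if "i < n" for i
    using permutes_in_image[OF p, of i] that by simp
  have inj: "p i = p j \<longleftrightarrow> i = j" for i j
    using permutes_inj[OF p] by (auto dest: injD)
  have perm_rows: "det (mat n n (\<lambda>(i, j). A $$ (p i, j))) = signof p * det A"
    if "A \<in> carrier_mat n n" for A :: "'a poly mat"
    using det_permute_rows[OF that p] .
  define B where "B = transpose_mat (mat n n (\<lambda>(i, j). ?C $$ (p i, j)))"
  have C: "?C \<in> carrier_mat n n" by simp
  have B: "B \<in> carrier_mat n n" unfolding B_def by simp
  have "char_poly_matrix (mat n n (\<lambda>(i, j). f (p i) (p j)))
      = transpose_mat (mat n n (\<lambda>(i, j). B $$ (p i, j)))"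
    by (rule eq_matI) (auto simp: B_def char_poly_matrix_def pn inj)
  then have "char_poly (mat n n (\<lambda>(i, j). f (p i) (p j)))
      = det (mat n n (\<lambda>(i, j). B $$ (p i, j)))"
    unfolding char_poly_def by (simp add: det_transpose[of _ n])
  also have "\<dots> = signof p * det B"
    by (rule perm_rows[OF B])
  also have "det B = signof p * det ?C"
    unfolding B_def using perm_rows[OF C] by (simp add: det_transpose[of _ n])
  finally show ?thesis
    by (simp add: char_poly_def sign_def)
qed

lemma
  assumes "finite (pverts X)"
  shows distinct_vertex_list: "distinct (vertex_list X)"
    and set_vertex_list: "set (vertex_list X) = pverts X"
    and length_vertex_list: "length (vertex_list X) = card (pverts X)"
proof -
  have "\<exists>vs. distinct vs \<and> set vs = pverts X"
    using finite_distinct_list[OF assms] by blast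
  from someI_ex[OF this] show 1: "distinct (vertex_list X)" "set (vertex_list X) = pverts X"
    unfolding vertex_list_def by auto
  then show "length (vertex_list X) = card (pverts X)"
    by (metis distinct_card)
qed

text \<open>
  This frees the choice of the enumeration: for a join, the vertices of the first graph can be
  listed before those of the second, which gives the distance matrix its block form.
\<close>

lemma char_poly_vertex_matrix:
  assumes "distinct vs" and "set vs = pverts X"
  shows "char_poly (vertex_matrix X f)
      = char_poly (mat (length vs) (length vs) (\<lambda>(i, j). f (vs ! i) (vs ! j)))"
proof -
  define us where "us = vertex_list X"
  have "finite (pverts X)"
    using assms(2) by (metis List.finite_set)
  then have us: "distinct us" "set us = pverts X"
    unfolding us_def by (simp_all add: distinct_vertex_list set_vertex_list)
  then have "mset us = mset vs"
    using assms set_eq_iff_mset_eq_distinct by metis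
  then obtain p where p: "p permutes {..<length vs}" "permute_list p vs = us"
    by (rule mset_eq_permutation)
  have nth: "us ! i = vs ! p i" if "i < length vs" for i
    using p that permute_list_nth by metis
  have "card (pverts X) = length vs"
    using assms distinct_card by metis
  then have "vertex_matrix X f
      = mat (length vs) (length vs) (\<lambda>(i, j). f (vs ! p i) (vs ! p j))"
    unfolding vertex_matrix_def us_def[symmetric] by (intro eq_matI) (auto simp: nth)
  moreover have "p permutes {0..<length vs}"
    using p(1) by (simp add: lessThan_atLeast0)
  ultimately show ?thesis
    using char_poly_permute[of p "length vs" "\<lambda>i j. f (vs ! i) (vs ! j)"] by simp
qed

section \<open>The characteristic polynomial of a quotient matrix\<close>

lemma char_poly_block_upper_triangular:
  fixes A :: "'a :: idom mat"
  assumes A: "A \<in> carrier_mat n n" and B: "B \<in> carrier_mat n m" and D: "D \<in> carrier_mat m m"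
  shows "char_poly (four_block_mat A B (0\<^sub>m m n) D) = char_poly A * char_poly D"
proof -
  have "char_poly_matrix (four_block_mat A B (0\<^sub>m m n) D)
      = four_block_mat (char_poly_matrix A) (map_mat (\<lambda>a. [:- a:]) B) (0\<^sub>m m n) (char_poly_matrix D)"
    by (rule eq_matI) (use assms in \<open>auto simp: char_poly_matrix_def\<close>)
  then show ?thesis
    unfolding char_poly_def
    by (simp add: det_four_block_mat_lower_left_zero[of _ n _ m] A B D)
qed

lemma char_poly_eq_of_intertwining:
  fixes K L :: "'a :: comm_ring_1 mat"
  assumes K: "K \<in> carrier_mat N N" and L: "L \<in> carrier_mat N N"
    and P: "P \<in> carrier_mat N N" and Q: "Q \<in> carrier_mat N N"
    and PQ: "P * Q = 1\<^sub>m N" and QP: "Q * P = 1\<^sub>m N"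
    and KP: "K * P = P * L"
  shows "char_poly K = char_poly L"
proof (rule char_poly_similar, rule similar_matI)
  have "P * L * Q = K * (P * Q)"
    unfolding KP[symmetric] using K P Q by (rule assoc_mult_mat)
  then show "K = P * L * Q"
    using K PQ by simp
qed (use assms in auto)

text \<open>
  The matrix \<open>I + c E\<close>, where \<open>E\<close> has ones in column 0 below row \<open>m\<close>. Multiplying by it from the
  left adds \<open>c\<close> times row 0 to each row below \<open>m\<close>; multiplying from the right adds \<open>c\<close> times each
  column beyond \<open>m\<close> to column 0.
\<close>

definition shear :: "nat \<Rightarrow> nat \<Rightarrow> 'a \<Rightarrow> 'a :: comm_ring_1 mat" where
  "shear N m c = mat N N (\<lambda>(i, j). (if i = j then 1 else 0) + (if j = 0 \<and> m < i then c else 0))"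

lemma shear_carrier [simp]: "shear N m c \<in> carrier_mat N N"
  by (simp add: shear_def)

lemma shear_mult_left:
  assumes "M \<in> carrier_mat N N" "i < N" "j < N"
  shows "(shear N m c * M) $$ (i, j) = M $$ (i, j) + (if m < i then c * M $$ (0, j) else 0)"
proof -
  have "(shear N m c * M) $$ (i, j)
      = (\<Sum>h = 0..<N. ((if i = h then 1 else 0) + (if h = 0 \<and> m < i then c else 0)) * M $$ (h, j))"
    using assms by (simp add: shear_def scalar_prod_def)
  also have "\<dots> = (\<Sum>h = 0..<N. (if i = h then M $$ (h, j) else 0)
      + (if h = 0 then (if m < i then c * M $$ (h, j) else 0) else 0))"
    by (intro sum.cong) (auto simp: distrib_right)
  finally show ?thesis
    using assms by (simp add: sum.distrib)
qed

lemma shear_mult_right: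
  assumes "M \<in> carrier_mat N N" "i < N" "j < N"
  shows "(M * shear N m c) $$ (i, j)
    = M $$ (i, j) + (if j = 0 then c * (\<Sum>h = Suc m..<N. M $$ (i, h)) else 0)"
proof -
  have "(M * shear N m c) $$ (i, j)
      = (\<Sum>h = 0..<N. M $$ (i, h) * ((if h = j then 1 else 0) + (if j = 0 \<and> m < h then c else 0)))"
    using assms by (simp add: shear_def scalar_prod_def)
  also have "\<dots> = (\<Sum>h = 0..<N. (if h = j then M $$ (i, h) else 0)
      + (if m < h then (if j = 0 then c * M $$ (i, h) else 0) else 0))"
    by (intro sum.cong) (auto simp: distrib_left mult.commute)
  also have "\<dots> = M $$ (i, j) + (\<Sum>h = Suc m..<N. if j = 0 then c * M $$ (i, h) else 0)"
    using assms by (simp add: sum.distrib)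
      (auto simp: sum.If_cases intro!: sum.cong)
  finally show ?thesis
    by (simp add: sum_distrib_left)
qed

lemma shear_inverse: "shear N m c * shear N m (- c) = 1\<^sub>m N"
proof (rule eq_matI)
  fix i j assume "i < dim_row (1\<^sub>m N :: 'a mat)" "j < dim_col (1\<^sub>m N :: 'a mat)"
  then have "i < N" "j < N" by auto
  then show "(shear N m c * shear N m (- c)) $$ (i, j) = (1\<^sub>m N :: 'a mat) $$ (i, j)"
    unfolding shear_mult_left[OF shear_carrier \<open>i < N\<close> \<open>j < N\<close>] by (auto simp: shear_def)
qed (auto simp: shear_def)

text \<open>
  Only the row sums of \<open>B\<close> matter to the part of the spectrum that sees the other block. Both
  sides are characteristic polynomials of matrices of size \<open>1 + m + n\<close>: \<open>K\<close>, which borders the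
  given block matrix by a coordinate with eigenvalue \<open>\<beta>\<close>, and \<open>L\<close>, which has the quotient
  matrix and \<open>B\<close> on its diagonal. The extra coordinate 0 stands for the all-ones vector on the last
  \<open>n\<close> coordinates, and the shear that adds it to each of those conjugates \<open>L\<close> into \<open>K\<close>.
\<close>

lemma char_poly_quotient:
  fixes M B :: "'a :: idom mat" and b b' :: "nat \<Rightarrow> 'a" and c \<beta> :: 'a
  assumes M: "M \<in> carrier_mat m m" and B: "B \<in> carrier_mat n n"
    and row_sum: "\<And>i. i < n \<Longrightarrow> (\<Sum>j<n. B $$ (i, j)) = \<beta>"
  shows "char_poly (four_block_mat M (mat m n (\<lambda>(i, j). b i)) (mat n m (\<lambda>(i, j). b' j))
            (mat n n (\<lambda>(i, j). c + B $$ (i, j)))) * [:- \<beta>, 1:]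
       = char_poly (four_block_mat (mat 1 1 (\<lambda>_. of_nat n * c + \<beta>)) (mat 1 m (\<lambda>(i, j). b' j))
            (mat m 1 (\<lambda>(i, j). of_nat n * b i)) M) * char_poly B"
    (is "char_poly ?D * _ = char_poly ?Q * _")
proof -
  define N where "N = 1 + (m + n)"
  define \<beta>mat where "\<beta>mat = mat 1 1 (\<lambda>_ :: nat \<times> nat. \<beta>)"
  define K where "K = four_block_mat \<beta>mat
    (mat 1 (m + n) (\<lambda>(i, j). if j < m then b' j else c)) (0\<^sub>m (m + n) 1) ?D"
  define L where "L = four_block_mat ?Q
    (mat (1 + m) n (\<lambda>(i, j). if i = 0 then c else b (i - 1))) (0\<^sub>m n (1 + m)) B"
  have D: "?D \<in> carrier_mat (m + n) (m + n)" and Q: "?Q \<in> carrier_mat (1 + m) (1 + m)"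
    using M B by auto
  have K: "K \<in> carrier_mat N N"
    unfolding K_def N_def by (rule four_block_carrier_mat[OF _ D]) (simp add: \<beta>mat_def)
  have L: "L \<in> carrier_mat N N"
    using four_block_carrier_mat[OF Q B] unfolding L_def N_def by (simp add: add.assoc)
  \<comment> \<open>Only column 0 needs \<open>row_sum\<close>: over the last \<open>n\<close> columns, each of the last \<open>n\<close> rows of \<open>K\<close>
    sums to \<open>n * c + \<beta>\<close>, the corner entry of the quotient matrix.\<close>
  have "K * shear N m 1 = shear N m 1 * L"
  proof (rule eq_matI)
    fix i j assume "i < dim_row (shear N m 1 * L)" "j < dim_col (shear N m 1 * L)"
    then have i: "i < N" and j: "j < N"
      using L by (auto simp: shear_def)
    have tail: "(\<Sum>h = Suc m..<N. K $$ (i, h)) = (\<Sum>h<n. K $$ (i, Suc (m + h)))"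
      by (rule sum.reindex_bij_witness[of _ "\<lambda>h. Suc (m + h)" "\<lambda>h. h - Suc m"]) (auto simp: N_def)
    have row: "(\<Sum>h<n. B $$ (i - Suc m, h)) = \<beta>" if "m < i"
      using row_sum[of "i - Suc m"] i that by (simp add: N_def)
    show "(K * shear N m 1) $$ (i, j) = (shear N m 1 * L) $$ (i, j)"
      unfolding shear_mult_left[OF L i j] shear_mult_right[OF K i j] tail
      using i j M B row
      by (auto simp: K_def L_def N_def \<beta>mat_def sum.distrib not_less Suc_le_eq less_Suc_eq_0_disj)
  qed (use K L in \<open>auto simp: shear_def\<close>)
  then have "char_poly K = char_poly L"
    using char_poly_eq_of_intertwining[OF K L, of "shear N m 1" "shear N m (- 1)"]
      shear_inverse[of N m 1] shear_inverse[of N m "- 1"] by simp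
  moreover have "char_poly K = char_poly \<beta>mat * char_poly ?D"
    unfolding K_def by (rule char_poly_block_upper_triangular) (use D in \<open>auto simp: \<beta>mat_def\<close>)
  moreover have "char_poly L = char_poly ?Q * char_poly B"
    unfolding L_def by (rule char_poly_block_upper_triangular) (use Q B in auto)
  moreover have "char_poly \<beta>mat = [:- \<beta>, 1:]"
    by (simp add: \<beta>mat_def char_poly_def char_poly_matrix_def det_single)
  ultimately show ?thesis
    by (simp add: mult.commute)
qed

section \<open>Spectra of real symmetric matrices\<close>

text \<open>
  For an eigenvector \<open>v\<close>, the number \<open>v\<^sup>* A v = a |v|\<^sup>2\<close> equals its own conjugate because \<open>A\<close>
  is real and symmetric.
\<close>

lemma eigenvalue_real_symmetric:
  fixes A :: "real mat"
  assumes A: "A \<in> carrier_mat n n"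
    and sym: "\<And>i j. i < n \<Longrightarrow> j < n \<Longrightarrow> A $$ (i, j) = A $$ (j, i)"
    and ev: "eigenvalue (map_mat complex_of_real A) a"
  shows "Im a = 0"
proof -
  define C where "C = map_mat complex_of_real A"
  have C: "C \<in> carrier_mat n n" using A by (simp add: C_def)
  obtain v where v: "v \<in> carrier_vec n" "v \<noteq> 0\<^sub>v n" "C *\<^sub>v v = a \<cdot>\<^sub>v v"
    using ev C unfolding C_def[symmetric] eigenvalue_def eigenvector_def by auto
  define s where "s = v \<bullet>c v"
  have "s \<noteq> 0"
    using v by (simp add: s_def)
  have s_sum: "s = (\<Sum>i<n. v $ i * cnj (v $ i))"
    using v by (simp add: s_def scalar_prod_def lessThan_atLeast0)
  have Cv: "(\<Sum>j<n. of_real (A $$ (i, j)) * v $ j) = a * v $ i" if "i < n" for i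
  proof -
    have "(C *\<^sub>v v) $ i = (\<Sum>j<n. of_real (A $$ (i, j)) * v $ j)"
      using that v(1) A by (simp add: C_def scalar_prod_def lessThan_atLeast0)
    then show ?thesis using v that by simp
  qed
  define t where "t = (\<Sum>i<n. \<Sum>j<n. of_real (A $$ (i, j)) * v $ j * cnj (v $ i))"
  have t: "t = a * s"
    unfolding t_def s_sum sum_distrib_left sum_distrib_right[symmetric]
    using Cv by (auto intro!: sum.cong simp: mult.assoc)
  have "cnj t = (\<Sum>i<n. \<Sum>j<n. of_real (A $$ (i, j)) * cnj (v $ j) * v $ i)"
    by (simp add: t_def)
  also have "\<dots> = (\<Sum>j<n. \<Sum>i<n. of_real (A $$ (i, j)) * cnj (v $ j) * v $ i)"
    by (rule sum.swap)
  also have "\<dots> = t"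
    unfolding t_def by (intro sum.cong refl) (auto simp: sym mult_ac)
  finally have "cnj t = t" .
  moreover have "cnj s = s"
    by (simp add: s_sum mult.commute)
  ultimately have "cnj a = a"
    using \<open>s \<noteq> 0\<close> unfolding t by simp
  then show ?thesis
    by (simp add: complex_eq_iff)
qed

lemma real_symmetric_char_poly_splits:
  fixes A :: "real mat"
  assumes A: "A \<in> carrier_mat n n"
    and sym: "\<And>i j. i < n \<Longrightarrow> j < n \<Longrightarrow> A $$ (i, j) = A $$ (j, i)"
  shows "\<exists>as. char_poly A = (\<Prod>a\<leftarrow>as. [:- a, 1:])"
proof -
  \<comment> \<open>Over \<open>\<complex>\<close> the polynomial splits; its roots are real, so the factorisation descends to \<open>\<real>\<close>.\<close>
  interpret of_real_poly: map_poly_inj_idom_hom complex_of_real ..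
  define C where "C = map_mat complex_of_real A"
  have C: "C \<in> carrier_mat n n" using A by (simp add: C_def)
  obtain as where as: "char_poly C = (\<Prod>a\<leftarrow>as. [:- a, 1:])"
    using char_poly_factorized[OF C] by blast
  have "of_real (Re a) = a" if "a \<in> set as" for a
  proof -
    have "poly (char_poly C) a = 0"
      unfolding as using that by (force simp: poly_prod_list prod_list_zero_iff)
    then have "eigenvalue C a"
      using eigenvalue_root_char_poly[OF C] by simp
    then show ?thesis
      using eigenvalue_real_symmetric[OF A sym] by (simp add: C_def complex_eq_iff)
  qed
  then have "as = map complex_of_real (map Re as)"
    by (simp add: map_idI)
  then obtain bs where bs: "as = map complex_of_real bs" by blast
  have "map_poly complex_of_real (char_poly A) = char_poly C"
    unfolding C_def by (rule of_real_hom.char_poly_hom[OF A, symmetric])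
  also have "\<dots> = map_poly complex_of_real (\<Prod>b\<leftarrow>bs. [:- b, 1:])"
    unfolding as bs of_real_poly.hom_prod_list by (simp add: o_def)
  finally show ?thesis
    using of_real_poly.injectivity by blast
qed

text \<open>
  A Schur decomposition \<open>A = P B Q\<close> with \<open>Q P = I\<close> has the roots on the diagonal of the triangular
  matrix \<open>B\<close>, and the trace is invariant under cyclic permutation of the factors.
\<close>

lemma sum_list_roots_eq_trace:
  fixes A :: "real mat"
  assumes A: "A \<in> carrier_mat n n" and as: "char_poly A = (\<Prod>a\<leftarrow>as. [:- a, 1:])"
  shows "sum_list as = (\<Sum>i<n. A $$ (i, i))"
proof -
  obtain B P Q where "schur_decomposition A as = (B, P, Q)"
    by (cases "schur_decomposition A as") auto
  from schur_decomposition[OF A as this]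
  have sim: "similar_mat_wit A B P Q" and diag: "diag_mat B = as" by auto
  from similar_mat_witD2[OF A sim]
  have QP: "Q * P = 1\<^sub>m n" and APBQ: "A = P * B * Q"
    and B: "B \<in> carrier_mat n n" and P: "P \<in> carrier_mat n n" and Q: "Q \<in> carrier_mat n n" by auto
  define R where "R = P * B"
  have R: "R \<in> carrier_mat n n" using P B by (simp add: R_def)
  have QR: "Q * R = B"
    using B P Q QP assoc_mult_mat[OF Q P B] by (simp add: R_def)
  have "(\<Sum>i<n. A $$ (i, i)) = (\<Sum>i<n. \<Sum>k<n. R $$ (i, k) * Q $$ (k, i))"
    unfolding APBQ R_def[symmetric] using R Q
    by (intro sum.cong) (auto simp: scalar_prod_def lessThan_atLeast0)
  also have "\<dots> = (\<Sum>k<n. \<Sum>i<n. R $$ (i, k) * Q $$ (k, i))"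
    by (rule sum.swap)
  also have "\<dots> = (\<Sum>k<n. (Q * R) $$ (k, k))"
    using R Q by (intro sum.cong) (auto simp: scalar_prod_def lessThan_atLeast0 mult.commute)
  also have "\<dots> = sum_list as"
    unfolding QR diag[symmetric] diag_mat_def using B
    by (simp add: sum_list_distinct_conv_sum_set lessThan_atLeast0)
  finally show ?thesis by simp
qed

section \<open>Energy as a sum over roots\<close>

lemma proots_linear_factors: "proots (\<Prod>a\<leftarrow>as. [:- a, 1:]) = mset (as :: 'a :: idom list)"
proof (induction as)
  case (Cons a as)
  have "(\<Prod>a\<leftarrow>as. [:- a, 1:]) \<noteq> 0"
    by (auto simp: prod_list_zero_iff)
  then have "proots ([:- a, 1:] * (\<Prod>a\<leftarrow>as. [:- a, 1:])) = add_mset a (mset as)"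
    using Cons.IH by (subst proots_mult) (auto simp del: mult_pCons_left)
  then show ?case by simp
qed simp

lemma sum_mset_image_eq_sum_count:
  fixes f :: "'a \<Rightarrow> real"
  shows "(\<Sum>x\<in>#M. f x) = (\<Sum>x\<in>set_mset M. real (count M x) * f x)"
proof (induction M)
  case (add x M)
  have "(\<Sum>y\<in>set_mset (add_mset x M). real (count (add_mset x M) y) * f y)
      = (\<Sum>y\<in>insert x (set_mset M). real (count M y) * f y + (if y = x then f y else 0))"
    by (intro sum.cong) (auto simp: distrib_right)
  also have "\<dots> = (\<Sum>y\<in>insert x (set_mset M). real (count M y) * f y) + f x"
    by (simp add: sum.distrib)
  also have "(\<Sum>y\<in>insert x (set_mset M). real (count M y) * f y)
      = (\<Sum>y\<in>set_mset M. real (count M y) * f y)"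
    by (rule sum.mono_neutral_right) (auto simp: not_in_iff)
  finally show ?case using add.IH by simp
qed simp

text \<open>
  As a function of the polynomial alone, the energy turns a factorisation of characteristic
  polynomials into a sum (\<open>root_energy_mult\<close>).
\<close>

definition root_energy :: "real poly \<Rightarrow> real" where
  "root_energy p = (\<Sum>x\<in>#proots p. \<bar>x\<bar>)"

lemma root_energy_mult: "p * q \<noteq> 0 \<Longrightarrow> root_energy (p * q) = root_energy p + root_energy q"
  by (simp add: root_energy_def proots_mult)

lemma distance_energy_eq_root_energy:
  "distance_energy X = root_energy (char_poly (distance_matrix X))"
proof -
  let ?p = "char_poly (distance_matrix X)"
  have A: "distance_matrix X \<in> carrier_mat (card (pverts X)) (card (pverts X))"
    by (simp add: distance_matrix_def vertex_matrix_def)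
  have "?p \<noteq> 0"
    using degree_monic_char_poly[OF A] by auto
  then show ?thesis
    unfolding distance_energy_def root_energy_def spectrum_root_char_poly[OF A]
    by (simp add: sum_mset_image_eq_sum_count)
qed

section \<open>Graph distances\<close>

lemma relpow_iff_awalk:
  assumes "pair_wf_digraph X" and "u \<in> pverts X"
  shows "(u, v) \<in> parcs X ^^ n
    \<longleftrightarrow> (\<exists>p. pre_digraph.awalk (with_proj X) u p v \<and> length p = n)"
  using assms(2)
proof (induction n arbitrary: u)
  case 0
  interpret pair_wf_digraph X by fact
  show ?case using 0 by (auto simp: awalk_Nil_iff)
next
  case (Suc n)
  interpret pair_wf_digraph X by fact
  have "(u, v) \<in> parcs X ^^ Suc n \<longleftrightarrow> (\<exists>w. (u, w) \<in> parcs X \<and> (w, v) \<in> parcs X ^^ n)"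
    by (meson relpow_Suc_D2 relpow_Suc_I2)
  also have "\<dots> \<longleftrightarrow> (\<exists>w p. (u, w) \<in> parcs X \<and> awalk w p v \<and> length p = n)"
    using Suc.IH in_arcsD2 by blast
  also have "\<dots> \<longleftrightarrow> (\<exists>p. awalk u p v \<and> length p = Suc n)"
  proof
    assume "\<exists>w p. (u, w) \<in> parcs X \<and> awalk w p v \<and> length p = n"
    then obtain w p where "(u, w) \<in> parcs X" "awalk w p v" "length p = n" by blast
    then show "\<exists>p. awalk u p v \<and> length p = Suc n"
      by (intro exI[of _ "(u, w) # p"]) (simp add: awalk_Cons_iff)
  next
    assume "\<exists>p. awalk u p v \<and> length p = Suc n"
    then obtain e p where "awalk u (e # p) v" "length p = n"
      by (metis length_Suc_conv)
    then show "\<exists>w p. (u, w) \<in> parcs X \<and> awalk w p v \<and> length p = n"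
      by (intro exI[of _ "snd e"] exI[of _ p]) (simp add: awalk_Cons_iff)
  qed
  finally show ?case .
qed

text \<open>
  With unit weights, the infimum over walks is attained; in this form distances are accessible to
  induction on the length of a walk.
\<close>

lemma graph_dist_eq_Least_relpow:
  assumes X: "pair_wf_digraph X" and u: "u \<in> pverts X" and reach: "(u, v) \<in> (parcs X)\<^sup>*"
  shows "graph_dist X u v = real (LEAST n. (u, v) \<in> parcs X ^^ n)"
proof -
  interpret pair_wf_digraph X by fact
  define d where "d = (LEAST n. (u, v) \<in> parcs X ^^ n)"
  have cost: "awalk_cost (\<lambda>_. 1) p = real (length p)" for p :: "('a \<times> 'a) list"
    by (induction p) auto
  have "\<exists>n. (u, v) \<in> parcs X ^^ n"
    using reach by (simp add: rtrancl_power)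
  then have "(u, v) \<in> parcs X ^^ d"
    unfolding d_def by (rule LeastI_ex)
  then obtain p where p: "awalk u p v" "length p = d"
    using relpow_iff_awalk[OF X u] by blast
  have "\<mu> (\<lambda>_. 1) u v = ereal (real d)"
  proof (rule antisym)
    show "\<mu> (\<lambda>_. 1) u v \<le> ereal (real d)"
      using min_cost_le_walk_cost[OF p(1), of "\<lambda>_. 1"] p(2) by (simp add: cost)
    show "ereal (real d) \<le> \<mu> (\<lambda>_. 1) u v"
      unfolding \<mu>_def
    proof (rule INF_greatest)
      fix q assume "q \<in> {q. awalk u q v}"
      then have "(u, v) \<in> parcs X ^^ length q"
        using relpow_iff_awalk[OF X u] by blast
      then have "d \<le> length q"
        unfolding d_def by (rule Least_le)
      then show "ereal (real d) \<le> ereal (awalk_cost (\<lambda>_. 1) q)"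
        by (simp add: cost)
    qed
  qed
  then show ?thesis by (simp add: graph_dist_def d_def)
qed

lemma relpow_weak_hom:
  assumes hom: "\<And>p q. (p, q) \<in> R \<Longrightarrow> \<phi> p = \<phi> q \<or> (\<phi> p, \<phi> q) \<in> R'"
    and "(u, v) \<in> R ^^ n"
  shows "\<exists>k\<le>n. (\<phi> u, \<phi> v) \<in> R' ^^ k"
  using assms(2)
proof (induction n arbitrary: v)
  case 0
  then show ?case by auto
next
  case (Suc n)
  then obtain w where w: "(u, w) \<in> R ^^ n" "(w, v) \<in> R" by auto
  obtain k where k: "k \<le> n" "(\<phi> u, \<phi> w) \<in> R' ^^ k"
    using Suc.IH[OF w(1)] by blast
  from hom[OF w(2)] show ?case
  proof
    assume "\<phi> w = \<phi> v"
    then show ?thesis using k by (metis le_SucI)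
  next
    assume "(\<phi> w, \<phi> v) \<in> R'"
    then have "(\<phi> u, \<phi> v) \<in> R' ^^ Suc k" using k by auto
    then show ?thesis using k(1) by blast
  qed
qed

text \<open>
  A map that sends each arc to an arc or to a single vertex shortens walks, so it is 1-Lipschitz.
  Allowing arcs to collapse is what makes this applicable to contracting one side of a join.
\<close>

lemma graph_dist_weak_hom:
  assumes "pair_wf_digraph X" and "pair_wf_digraph Y"
    and "u \<in> pverts X" and "(u, v) \<in> (parcs X)\<^sup>*"
    and "\<phi> u \<in> pverts Y"
    and hom: "\<And>p q. (p, q) \<in> parcs X \<Longrightarrow> \<phi> p = \<phi> q \<or> (\<phi> p, \<phi> q) \<in> parcs Y"
  shows "graph_dist Y (\<phi> u) (\<phi> v) \<le> graph_dist X u v"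
proof -
  define d where "d = (LEAST n. (u, v) \<in> parcs X ^^ n)"
  have "\<exists>n. (u, v) \<in> parcs X ^^ n"
    using assms(4) by (simp add: rtrancl_power)
  then have "(u, v) \<in> parcs X ^^ d"
    unfolding d_def by (rule LeastI_ex)
  then obtain k where k: "k \<le> d" "(\<phi> u, \<phi> v) \<in> parcs Y ^^ k"
    using relpow_weak_hom[of "parcs X" \<phi> "parcs Y" u v d] hom by blast
  have reach: "(\<phi> u, \<phi> v) \<in> (parcs Y)\<^sup>*"
    using k(2) by (rule relpow_imp_rtrancl)
  have "(LEAST n. (\<phi> u, \<phi> v) \<in> parcs Y ^^ n) \<le> k"
    using k(2) by (rule Least_le)
  then show ?thesis
    using k(1) graph_dist_eq_Least_relpow[OF assms(2,5) reach] graph_dist_eq_Least_relpow[OF assms(1,3,4)]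
    by (simp add: d_def)
qed

lemma relpow_sym: "sym R \<Longrightarrow> (u, v) \<in> R ^^ n \<Longrightarrow> (v, u) \<in> R ^^ n"
proof (induction n arbitrary: v)
  case (Suc n)
  then obtain w where "(u, w) \<in> R ^^ n" "(w, v) \<in> R" by auto
  then show ?case using Suc by (meson relpow_Suc_I2 symD)
qed simp

lemma graph_dist_commute:
  assumes X: "pair_graph X" and "u \<in> pverts X" "v \<in> pverts X" and "(u, v) \<in> (parcs X)\<^sup>*"
  shows "graph_dist X u v = graph_dist X v u"
proof -
  interpret pair_graph X by fact
  have sym: "sym (parcs X)" by (rule pair_graphD(3)[OF X])
  have "(v, u) \<in> (parcs X)\<^sup>*"
    using assms(4) sym by (metis sym_rtrancl symD)
  moreover have "(u, v) \<in> parcs X ^^ n \<longleftrightarrow> (v, u) \<in> parcs X ^^ n" for n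
    using relpow_sym[OF sym] by blast
  ultimately show ?thesis
    using assms by (simp add: graph_dist_eq_Least_relpow pair_wf_digraph_axioms)
qed

lemma graph_dist_self:
  assumes "pair_wf_digraph X" "u \<in> pverts X"
  shows "graph_dist X u u = 0"
  using assms by (subst graph_dist_eq_Least_relpow) auto

lemma graph_dist_adjacent:
  assumes "pair_graph X" "(u, v) \<in> parcs X"
  shows "graph_dist X u v = 1"
proof -
  interpret pair_graph X by fact
  have "(LEAST n. (u, v) \<in> parcs X ^^ n) = 1"
  proof (rule Least_equality)
    fix n assume "(u, v) \<in> parcs X ^^ n"
    then show "1 \<le> n" using no_loops'[OF assms(2)] by (cases n) auto
  qed (use assms(2) in simp)
  then show ?thesis
    using assms in_arcsD1 by (simp add: graph_dist_eq_Least_relpow pair_wf_digraph_axioms r_into_rtrancl)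
qed

lemma graph_dist_common_neighbour:
  assumes X: "pair_graph X" and uw: "(u, w) \<in> parcs X" and wv: "(w, v) \<in> parcs X"
    and "u \<noteq> v" and "(u, v) \<notin> parcs X"
  shows "graph_dist X u v = 2"
proof -
  interpret pair_graph X by fact
  have two: "(u, v) \<in> parcs X ^^ 2"
    using uw wv by (auto simp: numeral_2_eq_2)
  have "(LEAST n. (u, v) \<in> parcs X ^^ n) = 2"
  proof (rule Least_equality)
    show "(u, v) \<in> parcs X ^^ 2" by (rule two)
  next
    fix n assume "(u, v) \<in> parcs X ^^ n"
    moreover from this have "n \<noteq> 0" using assms(4) by (cases n) auto
    moreover have "n \<noteq> 1" using calculation(1) assms(5) by auto
    ultimately show "2 \<le> n" by simp
  qed
  then show ?thesis
    using uw in_arcsD1 relpow_imp_rtrancl[OF two]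
    by (simp add: graph_dist_eq_Least_relpow pair_wf_digraph_axioms)
qed

lemma connected_if_rtrancl:
  assumes X: "pair_graph X" and "pverts X \<noteq> {}"
    and reach: "\<And>u v. u \<in> pverts X \<Longrightarrow> v \<in> pverts X \<Longrightarrow> (u, v) \<in> (parcs X)\<^sup>*"
  shows "Digraph_Component.connected (with_proj X)"
proof -
  interpret pair_graph X by fact
  have "(u, v) \<in> rtrancl_on (pverts X) ((parcs X)\<^sup>s)" if "u \<in> pverts X" "v \<in> pverts X" for u v
  proof (rule rtrancl_consistent_rtrancl_on)
    show "(u, v) \<in> ((parcs X)\<^sup>s)\<^sup>*"
      using reach[OF that] by (rule rtrancl_mono[THEN subsetD, rotated]) (auto simp: symcl_def)
  qed (use that in_arcsD1 in_arcsD2 in \<open>auto simp: symcl_def\<close>)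
  then show ?thesis
    unfolding connected_conv using assms(2) by simp
qed

lemma connected_imp_nonempty: "Digraph_Component.connected (with_proj X) \<Longrightarrow> pverts X \<noteq> {}"
  by (auto simp: connected_conv)

section \<open>The block of the regular graph\<close>

lemma adjacency_row_sum:
  assumes Y: "pair_graph Y" and "regular r Y" and i: "i < card (pverts Y)"
  shows "(\<Sum>j<card (pverts Y). adjacency_matrix Y $$ (i, j)) = real r"
proof -
  interpret pair_graph Y by fact
  let ?ys = "vertex_list Y"
  have ys: "distinct ?ys" "set ?ys = pverts Y" "length ?ys = card (pverts Y)"
    using distinct_vertex_list[OF pair_finite_verts] set_vertex_list[OF pair_finite_verts]
    by (auto simp flip: distinct_card)
  have v: "?ys ! i \<in> pverts Y"
    using i ys nth_mem by metis
  have "(\<Sum>j<card (pverts Y). adjacency_matrix Y $$ (i, j))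
      = (\<Sum>j<card (pverts Y). if (?ys ! i, ?ys ! j) \<in> parcs Y then 1 else 0)"
    using i by (intro sum.cong) (auto simp: adjacency_matrix_def vertex_matrix_def)
  also have "\<dots> = (\<Sum>w\<leftarrow>?ys. if (?ys ! i, w) \<in> parcs Y then 1 else 0)"
    using ys(3) by (simp add: sum_list_sum_nth lessThan_atLeast0)
  also have "\<dots> = (\<Sum>w\<in>pverts Y. if (?ys ! i, w) \<in> parcs Y then 1 else 0)"
    using ys by (simp add: sum_list_distinct_conv_sum_set)
  also have "\<dots> = real (card {w \<in> pverts Y. (?ys ! i, w) \<in> parcs Y})"
    using pair_finite_verts by (simp add: sum.If_cases Int_def)
  also have "card {w \<in> pverts Y. (?ys ! i, w) \<in> parcs Y} = card (out_arcs (with_proj Y) (?ys ! i))"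
    by (rule bij_betw_same_card[of "\<lambda>w. (?ys ! i, w)"])
      (auto simp: bij_betw_def inj_on_def out_arcs_def dest: in_arcsD2)
  also have "\<dots> = r"
    using assms(2) v by (simp add: regular_def out_degree_def)
  finally show ?thesis .
qed

text \<open>
  The matrix \<open>- 2 I - A(Y)\<close>. Adding 2 to each entry gives the matrix with entries 0 on the
  diagonal, 1 at adjacent pairs and 2 elsewhere: the distances between the vertices of \<open>Y\<close> in
  a join.
\<close>

definition neg_shifted_adjacency :: "'a pair_pre_digraph \<Rightarrow> real mat" where
  "neg_shifted_adjacency Y = vertex_matrix Y
     (\<lambda>u v. (if u = v then - 2 else 0) - (if (u, v) \<in> parcs Y then 1 else 0))"

lemma neg_shifted_adjacency_entry:
  assumes "finite (pverts Y)" "i < card (pverts Y)" "j < card (pverts Y)"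
  shows "neg_shifted_adjacency Y $$ (i, j) = (if i = j then - 2 else 0) - adjacency_matrix Y $$ (i, j)"
proof -
  have "vertex_list Y ! i = vertex_list Y ! j \<longleftrightarrow> i = j"
    using assms distinct_vertex_list length_vertex_list by (metis nth_eq_iff_index_eq)
  then show ?thesis
    using assms by (simp add: neg_shifted_adjacency_def adjacency_matrix_def vertex_matrix_def)
qed

text \<open>
  The map \<open>b \<mapsto> - 2 - b\<close> sends the eigenvalues of \<open>- 2 I - A(Y)\<close> to those of \<open>A(Y)\<close>. This is
  where the bound \<open>- 2\<close> on the least adjacency eigenvalue enters.
\<close>

lemma neg_shifted_adjacency_eigenvalue_nonpos:
  assumes Y: "pair_graph Y" and least: "least_adjacency_eigenvalue Y \<ge> - 2"
    and ev: "eigenvalue (neg_shifted_adjacency Y) b"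
  shows "b \<le> 0"
proof -
  let ?n = "card (pverts Y)" and ?A = "adjacency_matrix Y" and ?B = "neg_shifted_adjacency Y"
  have A: "?A \<in> carrier_mat ?n ?n" and B: "?B \<in> carrier_mat ?n ?n"
    by (simp_all add: adjacency_matrix_def neg_shifted_adjacency_def vertex_matrix_def)
  obtain v where v: "v \<in> carrier_vec ?n" "v \<noteq> 0\<^sub>v ?n" and Bv: "?B *\<^sub>v v = b \<cdot>\<^sub>v v"
    using ev B unfolding eigenvalue_def eigenvector_def by auto
  have "?A *\<^sub>v v = (- 2 - b) \<cdot>\<^sub>v v"
  proof (rule eq_vecI)
    fix i assume "i < dim_vec ((- 2 - b) \<cdot>\<^sub>v v)"
    then have i: "i < ?n" using v(1) by simp
    have "b * v $ i = (?B *\<^sub>v v) $ i"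
      unfolding Bv using i v(1) by simp
    also have "\<dots> = (\<Sum>j<?n. ?B $$ (i, j) * v $ j)"
      using i v(1) B by (simp add: scalar_prod_def lessThan_atLeast0)
    also have "\<dots> = (\<Sum>j<?n. (if i = j then - 2 * v $ j else 0) - ?A $$ (i, j) * v $ j)"
      using i pair_graphD(1)[OF Y]
      by (intro sum.cong) (auto simp: neg_shifted_adjacency_entry left_diff_distrib)
    also have "\<dots> = - 2 * v $ i - (\<Sum>j<?n. ?A $$ (i, j) * v $ j)"
      using i by (simp add: sum_subtractf)
    also have "(\<Sum>j<?n. ?A $$ (i, j) * v $ j) = (?A *\<^sub>v v) $ i"
      using i v(1) A by (simp add: scalar_prod_def lessThan_atLeast0)
    finally show "(?A *\<^sub>v v) $ i = ((- 2 - b) \<cdot>\<^sub>v v) $ i"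
      using i v(1) by (simp add: left_diff_distrib)
  qed (use A v(1) in auto)
  then have "- 2 - b \<in> spectrum ?A"
    using A v unfolding spectrum_def eigenvalue_def eigenvector_def by auto
  then have "least_adjacency_eigenvalue Y \<le> - 2 - b"
    unfolding least_adjacency_eigenvalue_def using card_finite_spectrum(1)[OF A] by simp
  then show ?thesis using least by simp
qed

text \<open>
  As no eigenvalue is positive, the sum of absolute values is minus the trace, so it no longer
  depends on the individual eigenvalues of \<open>Y\<close>.
\<close>

lemma root_energy_neg_shifted_adjacency:
  assumes Y: "pair_graph Y" and least: "least_adjacency_eigenvalue Y \<ge> - 2"
  shows "root_energy (char_poly (neg_shifted_adjacency Y)) = 2 * real (card (pverts Y))"
proof -
  interpret pair_graph Y by fact
  let ?n = "card (pverts Y)" and ?B = "neg_shifted_adjacency Y"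
  have B: "?B \<in> carrier_mat ?n ?n"
    by (simp add: neg_shifted_adjacency_def vertex_matrix_def)
  have "?B $$ (i, j) = ?B $$ (j, i)" if "i < ?n" "j < ?n" for i j
    using that arcs_symmetric by (auto simp: neg_shifted_adjacency_def vertex_matrix_def)
  then obtain bs where bs: "char_poly ?B = (\<Prod>b\<leftarrow>bs. [:- b, 1:])"
    using real_symmetric_char_poly_splits[OF B] by blast
  have no_loop: "(v, v) \<notin> parcs Y" for v
    using no_loops' by blast
  have nonpos: "b \<le> 0" if "b \<in> set bs" for b
  proof -
    have "poly (char_poly ?B) b = 0"
      unfolding bs using that by (force simp: poly_prod_list prod_list_zero_iff)
    then show ?thesis
      using neg_shifted_adjacency_eigenvalue_nonpos[OF Y least] eigenvalue_root_char_poly[OF B] by simp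
  qed
  have "root_energy (char_poly ?B) = (\<Sum>b\<leftarrow>bs. \<bar>b\<bar>)"
    unfolding root_energy_def bs proots_linear_factors by (simp add: sum_mset_sum_list flip: mset_map)
  also have "\<dots> = (\<Sum>b\<leftarrow>bs. - b)"
    using nonpos by (intro arg_cong[of _ _ sum_list] map_cong) (auto simp: abs_of_nonpos)
  also have "\<dots> = - sum_list bs"
    using uminus_sum_list_map[of "\<lambda>b. b" bs] by (simp add: o_def)
  also have "\<dots> = - (\<Sum>i<?n. ?B $$ (i, i))"
    using sum_list_roots_eq_trace[OF B bs] by simp
  also have "\<dots> = 2 * real ?n"
    using no_loop by (simp add: neg_shifted_adjacency_def vertex_matrix_def)
  finally show ?thesis .
qed

section \<open>Distances in joins along a dominating set\<close>

text \<open>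
  Domination lets every vertex of the join reach \<open>Y\<close> within two steps, which connects the join.
\<close>

locale dominated_join =
  fixes X :: "'a pair_pre_digraph" and S :: "'a set" and Y :: "'b pair_pre_digraph"
  assumes X: "pair_graph X" and Y: "pair_graph Y"
    and S_subset: "S \<subseteq> pverts X" and S_nonempty: "S \<noteq> {}" and Y_nonempty: "pverts Y \<noteq> {}"
    and dominating: "\<And>u. u \<in> pverts X \<Longrightarrow> u \<in> S \<or> (\<exists>s\<in>S. (u, s) \<in> parcs X)"
begin

abbreviation J where "J \<equiv> join_on S X Y"

lemma J: "pair_graph J"
  by (rule pair_graph_join_on[OF X Y S_subset])

lemma verts_J: "pverts J = Inl ` pverts X \<union> Inr ` pverts Y"
  by (simp add: join_on_def)

lemma reach_Y: "u \<in> pverts J \<Longrightarrow> h \<in> pverts Y \<Longrightarrow> (u, Inr h) \<in> (parcs J)\<^sup>*"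
proof -
  assume u: "u \<in> pverts J" and h: "h \<in> pverts Y"
  obtain s where s: "s \<in> S" using S_nonempty by blast
  have step: "(Inl s', Inr h) \<in> parcs J" if "s' \<in> S" for s'
    using that h by (simp add: join_on_def)
  show ?thesis
  proof (cases u)
    case (Inl x)
    then have "x \<in> pverts X" using u by (auto simp: verts_J)
    from dominating[OF this] show ?thesis
    proof
      assume "x \<in> S"
      then show ?thesis using step Inl by blast
    next
      assume "\<exists>s\<in>S. (x, s) \<in> parcs X"
      then obtain s' where "s' \<in> S" "(x, s') \<in> parcs X" by blast
      then have "(Inl x, Inl s') \<in> parcs J" "(Inl s', Inr h) \<in> parcs J"
        using step by (auto simp: join_on_def)
      then show ?thesis
        unfolding Inl by (meson converse_rtrancl_into_rtrancl r_into_rtrancl)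
    qed
  next
    case (Inr k)
    then have "(Inr k, Inl s) \<in> parcs J"
      using u s by (auto simp: verts_J join_on_def)
    then show ?thesis
      unfolding Inr using step[OF s] by (meson converse_rtrancl_into_rtrancl r_into_rtrancl)
  qed
qed

lemma reach_J: "u \<in> pverts J \<Longrightarrow> v \<in> pverts J \<Longrightarrow> (u, v) \<in> (parcs J)\<^sup>*"
proof -
  assume "u \<in> pverts J" "v \<in> pverts J"
  moreover obtain h where "h \<in> pverts Y" using Y_nonempty by blast
  ultimately have "(u, Inr h) \<in> (parcs J)\<^sup>*" "(v, Inr h) \<in> (parcs J)\<^sup>*"
    by (simp_all add: reach_Y)
  then show ?thesis
    using pair_graphD(3)[OF J] by (meson rtrancl_trans sym_rtrancl symD)
qed

lemma connected_J: "Digraph_Component.connected (with_proj J)"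
  by (rule connected_if_rtrancl[OF J]) (use Y_nonempty reach_J in \<open>auto simp: verts_J\<close>)

lemma graph_dist_Y:
  assumes "h \<in> pverts Y" "k \<in> pverts Y"
  shows "graph_dist J (Inr h) (Inr k)
    = 2 + ((if h = k then - 2 else 0) - (if (h, k) \<in> parcs Y then 1 else 0))"
proof -
  interpret J: pair_graph J by (rule J)
  interpret Y: pair_graph Y by (rule Y)
  obtain s where s: "s \<in> S" using S_nonempty by blast
  consider "h = k" | "(h, k) \<in> parcs Y" "h \<noteq> k" | "h \<noteq> k" "(h, k) \<notin> parcs Y" by blast
  then show ?thesis
  proof cases
    case 1
    moreover have "(k, k) \<notin> parcs Y" using Y.no_loops' by blast
    ultimately show ?thesis
      using assms by (simp add: graph_dist_self J.pair_wf_digraph_axioms verts_J)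
  next
    case 2
    then have "(Inr h, Inr k) \<in> parcs J" by (simp add: join_on_def)
    then show ?thesis using 2 graph_dist_adjacent[OF J] by simp
  next
    case 3
    have "(Inr h, Inl s) \<in> parcs J" "(Inl s, Inr k) \<in> parcs J" "(Inr h, Inr k) \<notin> parcs J"
      using assms s 3 by (auto simp: join_on_def)
    then show ?thesis using 3 graph_dist_common_neighbour[OF J] by simp
  qed
qed

end

text \<open>
  The contraction of \<open>Y\<close> to the vertex \<open>k\<close> of \<open>Z\<close> is the identity on \<open>X\<close>, and an arc from \<open>S\<close> to
  \<open>Y\<close> becomes an arc from \<open>S\<close> to \<open>k\<close>; so \<open>graph_dist_weak_hom\<close> applies. Exchanging \<open>Y\<close> and \<open>Z\<close>
  turns the inequality into the two equalities that follow.
\<close>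

lemma graph_dist_join_collapse:
  fixes Y :: "'b pair_pre_digraph" and Z :: "'c pair_pre_digraph"
  assumes "dominated_join X S Y" and "dominated_join X S Z"
    and x: "x \<in> pverts X" and k: "k \<in> pverts Z" and v: "v \<in> pverts (join_on S X Y)"
  shows "graph_dist (join_on S X Z) (Inl x) (case v of Inl y \<Rightarrow> Inl y | Inr h \<Rightarrow> Inr k)
    \<le> graph_dist (join_on S X Y) (Inl x) v"
proof -
  interpret Y: dominated_join X S Y by fact
  interpret Z: dominated_join X S Z by fact
  interpret JY: pair_graph "join_on S X Y" by (rule Y.J)
  interpret JZ: pair_graph "join_on S X Z" by (rule Z.J)
  define \<phi> :: "'a + 'b \<Rightarrow> 'a + 'c" where "\<phi> w = (case w of Inl y \<Rightarrow> Inl y | Inr h \<Rightarrow> Inr k)" for w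
  have "graph_dist (join_on S X Z) (\<phi> (Inl x)) (\<phi> v) \<le> graph_dist (join_on S X Y) (Inl x) v"
  proof (rule graph_dist_weak_hom)
    show "(Inl x, v) \<in> (parcs (join_on S X Y))\<^sup>*"
      using x v by (simp add: Y.reach_J Y.verts_J)
    show "\<phi> p = \<phi> q \<or> (\<phi> p, \<phi> q) \<in> parcs (join_on S X Z)" if "(p, q) \<in> parcs (join_on S X Y)" for p q
      using that k by (auto simp: join_on_def \<phi>_def)
  qed (use x in \<open>auto simp: Y.verts_J Z.verts_J \<phi>_def JY.pair_wf_digraph_axioms JZ.pair_wf_digraph_axioms\<close>)
  then show ?thesis by (simp add: \<phi>_def)
qed

lemma graph_dist_join_X_X:
  assumes "dominated_join X S Y" and "dominated_join X S Z" and "x \<in> pverts X" "y \<in> pverts X"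
  shows "graph_dist (join_on S X Y) (Inl x) (Inl y) = graph_dist (join_on S X Z) (Inl x) (Inl y)"
proof -
  obtain h k where "h \<in> pverts Y" "k \<in> pverts Z"
    using assms(1,2)[THEN dominated_join.Y_nonempty] by blast
  then show ?thesis
    using graph_dist_join_collapse[OF assms(1,2,3) \<open>k \<in> _\<close>, of "Inl y"]
      graph_dist_join_collapse[OF assms(2,1,3) \<open>h \<in> _\<close>, of "Inl y"] assms
    by (simp add: dominated_join.verts_J)
qed

lemma graph_dist_join_X_Y:
  assumes "dominated_join X S Y" and "dominated_join X S Z"
    and "x \<in> pverts X" "h \<in> pverts Y" "k \<in> pverts Z"
  shows "graph_dist (join_on S X Y) (Inl x) (Inr h) = graph_dist (join_on S X Z) (Inl x) (Inr k)"
  using graph_dist_join_collapse[OF assms(1,2,3) \<open>k \<in> _\<close>, of "Inr h"]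
    graph_dist_join_collapse[OF assms(2,1,3) \<open>h \<in> _\<close>, of "Inr k"] assms
  by (simp add: dominated_join.verts_J)

section \<open>The distance energy of a join with a regular graph\<close>

text \<open>
  The join with a one-vertex graph serves as the representative of all joins along \<open>S\<close>: it is
  independent even of the vertex type of \<open>Y\<close>.
\<close>

definition cone :: "'a set \<Rightarrow> 'a pair_pre_digraph \<Rightarrow> ('a + unit) pair_pre_digraph" where
  "cone S X = join_on S X \<lparr> pverts = {()}, parcs = {} \<rparr>"

text \<open>
  The quotient of the distance matrix of \<open>join_on S X Y\<close> in which the \<open>n\<close> vertices of \<open>Y\<close> form one
  class, listed first. The corner entry is the row sum \<open>2 (n - 1) - r\<close> of the distances inside
  \<open>Y\<close>, split as \<open>n\<close> times 2 plus the row sum of \<open>- 2 I - A(Y)\<close>.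
\<close>

definition join_quotient :: "'a set \<Rightarrow> 'a pair_pre_digraph \<Rightarrow> nat \<Rightarrow> nat \<Rightarrow> real mat" where
  "join_quotient S X n r =
     (let m = card (pverts X); xs = vertex_list X; d = graph_dist (cone S X) in
      four_block_mat (mat 1 1 (\<lambda>_. real n * 2 + (- 2 - real r)))
        (mat 1 m (\<lambda>(i, j). d (Inl (xs ! j)) (Inr ())))
        (mat m 1 (\<lambda>(i, j). real n * d (Inl (xs ! i)) (Inr ())))
        (mat m m (\<lambda>(i, j). d (Inl (xs ! i)) (Inl (xs ! j)))))"

context dominated_join begin

lemma dominated_join_cone: "dominated_join X S \<lparr> pverts = {()}, parcs = {} \<rparr>"
  using X S_subset S_nonempty dominating
  by (intro dominated_join.intro) (auto intro!: pair_graphI simp: sym_def irrefl_def)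

lemma char_poly_distance_matrix_J:
  assumes "regular r Y"
  shows "char_poly (distance_matrix J) * [:2 + real r, 1:]
    = char_poly (join_quotient S X (card (pverts Y)) r) * char_poly (neg_shifted_adjacency Y)"
proof -
  let ?m = "card (pverts X)" and ?n = "card (pverts Y)"
  let ?xs = "vertex_list X" and ?ys = "vertex_list Y"
  let ?d = "graph_dist (cone S X)" and ?B = "neg_shifted_adjacency Y"
  let ?vs = "map Inl ?xs @ map Inr ?ys :: ('a + 'b) list"
  let ?M = "mat ?m ?m (\<lambda>(i, j). ?d (Inl (?xs ! i)) (Inl (?xs ! j)))"
  define b where "b i = ?d (Inl (?xs ! i)) (Inr ())" for i
  have finX: "finite (pverts X)" and finY: "finite (pverts Y)"
    using pair_graphD(1) X Y by blast+
  note xs = distinct_vertex_list[OF finX] set_vertex_list[OF finX] length_vertex_list[OF finX]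
  note ys = distinct_vertex_list[OF finY] set_vertex_list[OF finY] length_vertex_list[OF finY]
  have x: "?xs ! i \<in> pverts X" if "i < ?m" for i using that xs by (metis nth_mem)
  have y: "?ys ! i \<in> pverts Y" if "i < ?n" for i using that ys by (metis nth_mem)
  have dXX: "graph_dist J (Inl u) (Inl v) = ?d (Inl u) (Inl v)"
    if "u \<in> pverts X" "v \<in> pverts X" for u v
    unfolding cone_def using graph_dist_join_X_X[OF dominated_join_axioms dominated_join_cone] that .
  have dXY: "graph_dist J (Inl u) (Inr h) = ?d (Inl u) (Inr ())"
    if "u \<in> pverts X" "h \<in> pverts Y" for u h
    unfolding cone_def using graph_dist_join_X_Y[OF dominated_join_axioms dominated_join_cone] that by simp
  have dYX: "graph_dist J (Inr h) (Inl u) = ?d (Inl u) (Inr ())"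
    if "u \<in> pverts X" "h \<in> pverts Y" for u h
    using graph_dist_commute[OF J _ _ reach_J, of "Inr h" "Inl u"] dXY[OF that] that
    by (simp add: verts_J)
  have B: "?B \<in> carrier_mat ?n ?n"
    by (simp add: neg_shifted_adjacency_def vertex_matrix_def)
  have "mat (length ?vs) (length ?vs) (\<lambda>(i, j). graph_dist J (?vs ! i) (?vs ! j))
      = four_block_mat ?M (mat ?m ?n (\<lambda>(i, j). b i)) (mat ?n ?m (\<lambda>(i, j). b j))
          (mat ?n ?n (\<lambda>(i, j). 2 + ?B $$ (i, j)))"
    by (rule eq_matI)
      (auto simp: xs ys nth_append b_def dXX dXY dYX graph_dist_Y x y neg_shifted_adjacency_def vertex_matrix_def)
  moreover have "distinct ?vs" "set ?vs = pverts J"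
    by (auto simp: verts_J xs ys distinct_map)
  ultimately have D: "char_poly (distance_matrix J)
      = char_poly (four_block_mat ?M (mat ?m ?n (\<lambda>(i, j). b i)) (mat ?n ?m (\<lambda>(i, j). b j))
          (mat ?n ?n (\<lambda>(i, j). 2 + ?B $$ (i, j))))"
    unfolding distance_matrix_def using char_poly_vertex_matrix[of ?vs J "graph_dist J"] by simp
  have row: "(\<Sum>j<?n. ?B $$ (i, j)) = - 2 - real r" if "i < ?n" for i
    using that adjacency_row_sum[OF Y assms that]
    by (simp add: neg_shifted_adjacency_entry[OF finY] sum_subtractf)
  have M: "?M \<in> carrier_mat ?m ?m" by simp
  show ?thesis
    using char_poly_quotient[OF M B row, where b = b and c = 2 and b' = b]
    by (simp add: D join_quotient_def Let_def b_def add.commute del: mult_pCons_left mult_pCons_right)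
qed

text \<open>
  The energies of the factors in \<open>char_poly_distance_matrix_J\<close> add up; the linear factor with root
  \<open>- 2 - r\<close> accounts for the summand that is subtracted.
\<close>

lemma distance_energy_J:
  assumes "regular r Y" and "least_adjacency_eigenvalue Y \<ge> - 2"
  shows "distance_energy J = root_energy (char_poly (join_quotient S X (card (pverts Y)) r))
    + 2 * real (card (pverts Y)) - (2 + real r)"
proof -
  let ?D = "char_poly (distance_matrix J)" and ?Q = "char_poly (join_quotient S X (card (pverts Y)) r)"
    and ?B = "char_poly (neg_shifted_adjacency Y)"
  have "distance_matrix J \<in> carrier_mat (card (pverts J)) (card (pverts J))"
    by (simp add: distance_matrix_def vertex_matrix_def)
  then have "?D \<noteq> 0"
    using degree_monic_char_poly[of "distance_matrix J"] by auto
  then have nz: "?D * [:2 + real r, 1:] \<noteq> 0"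
    by (subst mult_eq_0_iff) simp
  have "root_energy ?D + root_energy [:2 + real r, 1:] = root_energy ?Q + root_energy ?B"
    using root_energy_mult[OF nz] root_energy_mult[of ?Q ?B] nz
    unfolding char_poly_distance_matrix_J[OF assms(1)] by simp
  moreover have "root_energy [:2 + real r, 1:] = 2 + real r"
    by (simp add: root_energy_def)
  ultimately show ?thesis
    unfolding distance_energy_eq_root_energy root_energy_neg_shifted_adjacency[OF Y assms(2)] by simp
qed

end

lemma D_equienergetic_joins:
  assumes "dominated_join X S Y" and "dominated_join X S Z"
    and "regular r Y" and "least_adjacency_eigenvalue Y \<ge> - 2"
    and "regular r Z" and "least_adjacency_eigenvalue Z \<ge> - 2"
    and "card (pverts Y) = card (pverts Z)"
  shows "D_equienergetic (join_on S X Y) (join_on S X Z)"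
proof -
  interpret Y: dominated_join X S Y by fact
  interpret Z: dominated_join X S Z by fact
  have fin: "finite (pverts X)" "finite (pverts Y)" "finite (pverts Z)"
    using pair_graphD(1) Y.X Y.Y Z.Y by blast+
  then have "card (pverts (join_on S X Y)) = card (pverts (join_on S X Z))"
    unfolding Y.verts_J Z.verts_J using assms(7)
    by (subst (1 2) card_Un_disjoint) (auto simp: card_image)
  moreover have "distance_energy (join_on S X Y) = distance_energy (join_on S X Z)"
    using Y.distance_energy_J[OF assms(3,4)] Z.distance_energy_J[OF assms(5,6)] assms(7) by simp
  ultimately show ?thesis
    unfolding D_equienergetic_def using Y.connected_J Z.connected_J by blast
qed

section \<open>Joins of central graphs\<close>

lemma central_graph_verts: "pverts (central_graph G) = Inl ` pverts G \<union> Inr ` edge_set G"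
  by (simp add: central_graph_def subdivision_graph_def)

lemma vertices_dominate_central_graph:
  assumes "pair_graph G" "pverts G \<noteq> {}" "pair_graph H" "pverts H \<noteq> {}"
  shows "dominated_join (central_graph G) (Inl ` pverts G) H"
proof (rule dominated_join.intro)
  show "u \<in> Inl ` pverts G \<or> (\<exists>s\<in>Inl ` pverts G. (u, s) \<in> parcs (central_graph G))"
    if u: "u \<in> pverts (central_graph G)" for u
  proof (cases u)
    case (Inr e)
    then have e: "e \<in> edge_set G" using u by (auto simp: central_graph_verts)
    then obtain v where "v \<in> e" by (auto simp: edge_set_def)
    then show ?thesis
      using e edge_set_in_verts[OF assms(1) e] Inr
      by (auto simp: central_graph_def subdivision_graph_def)
  qed (use u in \<open>auto simp: central_graph_verts\<close>)
qed (use assms pair_graph_central_graph in \<open>auto simp: central_graph_verts\<close>)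

text \<open>
  The midpoints adjacent to a vertex of \<open>G\<close> are those of its own edges, and regularity together
  with the existence of an edge guarantees that there is one.
\<close>

lemma edges_dominate_central_graph:
  assumes "pair_graph G" "edge_set G \<noteq> {}" "regular s G" "pair_graph H" "pverts H \<noteq> {}"
  shows "dominated_join (central_graph G) (Inr ` edge_set G) H"
proof (rule dominated_join.intro)
  interpret pair_graph G by fact
  obtain a b where "(a, b) \<in> parcs G"
    using assms(2) by (auto simp: edge_set_def)
  then have "out_degree (with_proj G) a > 0" "a \<in> pverts G"
    using pair_finite_arcs in_arcsD1 by (auto simp: out_degree_def out_arcs_def card_gt_0_iff)
  then have pos: "s > 0" using assms(3) by (auto simp: regular_def)
  show "u \<in> Inr ` edge_set G \<or> (\<exists>s\<in>Inr ` edge_set G. (u, s) \<in> parcs (central_graph G))"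
    if u: "u \<in> pverts (central_graph G)" for u
  proof (cases u)
    case (Inl v)
    then have "v \<in> pverts G" using u by (auto simp: central_graph_verts)
    then have "card (out_arcs (with_proj G) v) > 0"
      using assms(3) pos by (simp add: regular_def out_degree_def)
    then obtain w where "(v, w) \<in> parcs G"
      by (auto simp: card_gt_0_iff out_arcs_def)
    then have "{v, w} \<in> edge_set G" by (auto simp: edge_set_def)
    then show ?thesis
      using Inl by (auto simp: central_graph_def subdivision_graph_def)
  qed (use u in \<open>auto simp: central_graph_verts\<close>)
qed (use assms pair_graph_central_graph in \<open>auto simp: central_graph_verts\<close>)

theorem theorem4p5:
  fixes G :: "'a pair_pre_digraph"
    and H\<^sub>1 :: "'b pair_pre_digraph"
    and H\<^sub>2 :: "'c pair_pre_digraph"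
    and s r :: nat
  assumes "pair_graph G" and "Digraph_Component.connected (with_proj G)"
    and "triangle_free G" and "regular s G"
    and "pair_graph H\<^sub>1" and "Digraph_Component.connected (with_proj H\<^sub>1)"
    and "regular r H\<^sub>1" and "least_adjacency_eigenvalue H\<^sub>1 \<ge> - 2"
    and "pair_graph H\<^sub>2" and "Digraph_Component.connected (with_proj H\<^sub>2)"
    and "regular r H\<^sub>2" and "least_adjacency_eigenvalue H\<^sub>2 \<ge> - 2"
    and "card (pverts H\<^sub>1) = card (pverts H\<^sub>2)"
  shows "D_equienergetic (central_vertex_join G H\<^sub>1) (central_vertex_join G H\<^sub>2) \<and>
    (edge_set G \<noteq> {} \<longrightarrow>
      D_equienergetic (central_edge_join G H\<^sub>1) (central_edge_join G H\<^sub>2))"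
proof -
  note nonempty = assms(2,6,10)[THEN connected_imp_nonempty]
  show ?thesis
    unfolding central_vertex_join_def central_edge_join_def
    using assms nonempty
    by (auto intro!: D_equienergetic_joins[of _ _ _ _ r]
        vertices_dominate_central_graph edges_dominate_central_graph[of _ s])
qed

end
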